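(* Under the hypotheses and notation of the statement that $\psi$ is a faithful embedding (irreducible principally polarized tropical abelian surface $(X,Q)$, representatives $b_0,\dots,b_3$ of $M/2\lambda(M')$, $\psi:Y=X/\langle-1\rangle\to\mathbb{TP}^3$, $[x]\mapsto(\vartheta_{b_0}(x):\dots:\vartheta_{b_3}(x))$), set $\tau_0=(\vartheta_{b_0}(0):\vartheta_{b_1}(0):\vartheta_{b_2}(0):\vartheta_{b_3}(0))$. Let the Klein group $V_4=\{\mathrm{id},(0\,1)(2\,3),(0\,2)(1\,3),(0\,3)(1\,2)\}$ act on $\mathbb{TP}^3$ by permuting coordinates and let $\iota(x_0:\dots:x_3)=(-x_0:\dots:-x_3)$. Then $\psi(Y)$, viewed in the principal torus $\cong\mathbb{R}^3$, is the boundary surface of a parallelepiped whose eight vertices are the points $g\cdot\tau_0$, $g\in V_4\times\langle\iota\rangle$, namely $\tau_i=(0\,i)(j\,k)\cdot\tau_0$ and $\widetilde\tau_i=\iota(\tau_i)$ for $i=0,1,2,3$ (with $\{i,j,k\}=\{1,2,3\}$ for $i\neq 0$).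
   Context: $M$ free of rank 2, $N=\mathrm{Hom}(M,\mathbb{Z})\subseteq N_\mathbb{R}=\mathrm{Hom}(M,\mathbb{R})$, $M'\subseteq N_\mathbb{R}$ a full lattice, $X=N_\mathbb{R}/M'$. A principal polarization is a positive-definite symmetric bilinear form $Q$ on $N_\mathbb{R}$ with $Q(M'\times N)\subseteq\mathbb{Z}$ such that $\lambda:M'\to M$, $\lambda(u')=Q(u',\cdot)|_N$, is an isomorphism. $(X,Q)$ is irreducible if it is not isomorphic (via a $\mathbb{Z}$-isomorphism of integral structures carrying lattice to lattice and form to form) to a product $(E_1\times E_2,Q_1\oplus Q_2)$ of polarized one-dimensional tropical abelian varieties. $\vartheta_b(x)=\min_{u'\in M'}\big(2Q(x,u'+(2\lambda)_\mathbb{R}^{-1}(b))+Q(u'+(2\lambda)_\mathbb{R}^{-1}(b),u'+(2\lambda)_\mathbb{R}^{-1}(b))\big)$. The principal torus of $\mathbb{TP}^3$ is $\mathbb{R}^4/\mathbb{R}(1,1,1,1)\cong\mathbb{R}^3$. *)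

theory Defs
  imports "HOL-Analysis.Analysis" "HOL-Combinatorics.Transposition"
begin

text \<open>Conventions. M and N are identified with Z^2 (dual bases), so
  N_R = real^2, N = integer points of real^2, M = integer points of real^2
  with pairing m(n) = m \<bullet> n.  A symmetric bilinear form Q on N_R is a
  function of two arguments.\<close>

definition intpts :: "(real^2) set" where
  "intpts = {x. \<forall>i. x $ i \<in> \<int>}"

definition full_lattice :: "(real^2) set \<Rightarrow> bool" where
  "full_lattice L \<longleftrightarrow> (\<exists>u1 u2. u1 \<noteq> u2 \<and> independent {u1, u2} \<and>
      L = {of_int a *\<^sub>R u1 + of_int c *\<^sub>R u2 | a c. True})"

text \<open>lambda(u') = Q(u',.) restricted to N, written in the dual basis of M;
  its R-linear extension is given by the same formula on all of N_R.\<close>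
definition lam :: "(real^2 \<Rightarrow> real^2 \<Rightarrow> real) \<Rightarrow> real^2 \<Rightarrow> real^2" where
  "lam Q u = (\<chi> i. Q u (axis i 1))"

definition principal_polarization ::
  "(real^2 \<Rightarrow> real^2 \<Rightarrow> real) \<Rightarrow> (real^2) set \<Rightarrow> bool" where
  "principal_polarization Q L \<longleftrightarrow>
     full_lattice L \<and> bilinear Q \<and> (\<forall>x y. Q x y = Q y x) \<and>
     (\<forall>x. x \<noteq> 0 \<longrightarrow> Q x x > 0) \<and>
     (\<forall>u\<in>L. \<forall>n\<in>intpts. Q u n \<in> \<int>) \<and>
     bij_betw (lam Q) L intpts"

text \<open>Reducible: Z-isomorphic (linear iso of N_R carrying N onto N = Z^2,
  the lattice onto a product lattice (c1 Z) x (c2 Z), and the form onto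
  a sum of positive one-dimensional forms) to a product of polarized
  one-dimensional tropical abelian varieties.\<close>
definition reducible_pav :: "(real^2 \<Rightarrow> real^2 \<Rightarrow> real) \<Rightarrow> (real^2) set \<Rightarrow> bool" where
  "reducible_pav Q L \<longleftrightarrow>
     (\<exists>(\<phi>::real^2 \<Rightarrow> real^2) c1 c2 q1 q2.
        linear \<phi> \<and> bij \<phi> \<and> \<phi> ` intpts = intpts \<and>
        c1 \<noteq> 0 \<and> c2 \<noteq> 0 \<and> q1 > 0 \<and> q2 > 0 \<and>
        \<phi> ` L = {vector [of_int a * c1, of_int c * c2] | a c. True} \<and>
        (\<forall>x y. Q x y = q1 * (\<phi> x $ 1) * (\<phi> y $ 1) + q2 * (\<phi> x $ 2) * (\<phi> y $ 2)))"

definition irreducible_pav :: "(real^2 \<Rightarrow> real^2 \<Rightarrow> real) \<Rightarrow> (real^2) set \<Rightarrow> bool" where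
  "irreducible_pav Q L \<longleftrightarrow> \<not> reducible_pav Q L"

definition theta :: "(real^2 \<Rightarrow> real^2 \<Rightarrow> real) \<Rightarrow> (real^2) set \<Rightarrow> real^2 \<Rightarrow> real^2 \<Rightarrow> real" where
  "theta Q L b x =
     (let c = inv (\<lambda>v. 2 *\<^sub>R lam Q v) b
      in (INF u\<in>L. 2 * Q x (u + c) + Q (u + c) (u + c)))"

definition theta_reps :: "(real^2 \<Rightarrow> real^2 \<Rightarrow> real) \<Rightarrow> (real^2) set \<Rightarrow> (nat \<Rightarrow> real^2) \<Rightarrow> bool" where
  "theta_reps Q L b \<longleftrightarrow>
     (\<forall>i<4. b i \<in> intpts) \<and>
     (\<forall>i<4. \<forall>j<4. i \<noteq> j \<longrightarrow> b i - b j \<notin> (\<lambda>u. 2 *\<^sub>R lam Q u) ` L) \<and>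
     (\<forall>m\<in>intpts. \<exists>i<4. m - b i \<in> (\<lambda>u. 2 *\<^sub>R lam Q u) ` L)"

text \<open>Points of the principal torus R^4 / R(1,1,1,1) of TP^3, identified
  with real^3 via (x_0:...:x_3) \<mapsto> (x_1-x_0, x_2-x_0, x_3-x_0).
  Homogeneous coordinates are functions nat \<Rightarrow> real, indices 0..3.\<close>
definition torus_pt :: "(nat \<Rightarrow> real) \<Rightarrow> real^3" where
  "torus_pt x = vector [x 1 - x 0, x 2 - x 0, x 3 - x 0]"

definition klein4 :: "(nat \<Rightarrow> nat) set" where
  "klein4 = {id, Transposition.transpose (0::nat) 1 \<circ> Transposition.transpose (2::nat) 3, Transposition.transpose (0::nat) 2 \<circ> Transposition.transpose (1::nat) 3,
             Transposition.transpose (0::nat) 3 \<circ> Transposition.transpose (1::nat) 2}"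

definition perm_act :: "(nat \<Rightarrow> nat) \<Rightarrow> (nat \<Rightarrow> real) \<Rightarrow> (nat \<Rightarrow> real)" where
  "perm_act \<sigma> x = (\<lambda>i. x (inv \<sigma> i))"

definition iota :: "(nat \<Rightarrow> real) \<Rightarrow> (nat \<Rightarrow> real)" where
  "iota x = (\<lambda>i. - x i)"

definition klein_iota :: "((nat \<Rightarrow> real) \<Rightarrow> (nat \<Rightarrow> real)) set" where
  "klein_iota = perm_act ` klein4 \<union> (\<lambda>\<sigma>. iota \<circ> perm_act \<sigma>) ` klein4"

definition parallelepiped :: "real^3 \<Rightarrow> real^3 \<Rightarrow> real^3 \<Rightarrow> real^3 \<Rightarrow> (real^3) set" where
  "parallelepiped p v1 v2 v3 =
     {p + s *\<^sub>R v1 + t *\<^sub>R v2 + r *\<^sub>R v3 | s t r. s \<in> {0..1} \<and> t \<in> {0..1} \<and> r \<in> {0..1}}"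

definition parallelepiped_vertices :: "real^3 \<Rightarrow> real^3 \<Rightarrow> real^3 \<Rightarrow> real^3 \<Rightarrow> (real^3) set" where
  "parallelepiped_vertices p v1 v2 v3 =
     {p + s *\<^sub>R v1 + t *\<^sub>R v2 + r *\<^sub>R v3 | s t r. s \<in> {0,1} \<and> t \<in> {0,1} \<and> r \<in> {0,1}}"

end

theory Submission
  imports Defs
begin

text \<open>Put \<open>G z = min\<^bsub>u \<in> L\<^esub> Q(z + u, z + u)\<close>. Up to the summand \<open>Q(x, x)\<close>, which disappears in the
  torus, the four theta functions are \<open>G (x + c\<^sub>i)\<close>, where the \<open>c\<^sub>i\<close> represent \<open>(1/2) L / L\<close>.
  The lattice has a Selling superbase \<open>w\<^sub>0 + w\<^sub>1 + w\<^sub>2 = 0\<close> with all \<open>Q(w\<^sub>i, w\<^sub>j) \<le> 0\<close>; an orthogonal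
  pair would split the polarized surface, so irreducibility makes \<open>\<alpha> = - Q(w\<^sub>1, w\<^sub>2)\<close>,
  \<open>\<beta> = - Q(w\<^sub>0, w\<^sub>2)\<close> and \<open>\<gamma> = - Q(w\<^sub>0, w\<^sub>1)\<close> positive. In Hadamard coordinates of \<open>R^4\<close>, the
  parallelogram \<open>0 \<le> Q(x, w\<^sub>1) \<le> \<gamma>/2\<close>, \<open>0 \<le> Q(x, w\<^sub>2) \<le> \<beta>/2\<close> is mapped affinely onto the face
  with first coordinate \<open>- \<alpha>/2\<close> of the box with half-sides \<open>\<alpha>/2, \<beta>/2, \<gamma>/2\<close>. Translation by half
  lattice vectors flips the signs of two coordinates, and up to these translations and \<open>x \<mapsto> - x\<close> the
  plane is covered by this parallelogram and its two analogues.\<close>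

section \<open>Minimising quadratics over integer shifts\<close>

text \<open>The difference of the two sides is \<open>m * (2 * y + g * (m + 2 * p))\<close>, and for
  \<open>0 \<le> 2 * y \<le> g\<close> the two factors never have opposite signs. In this range
  \<open>0\<close> and \<open>- 1/2\<close> are both minimisers in their classes modulo
  integers.\<close>

lemma int_quadratic_min:
  fixes y g p :: real and m :: int
  assumes "0 \<le> 2 * y" "2 * y \<le> g" "p \<in> {0, - 1/2}"
  shows "2 * y * p + g * p\<^sup>2 \<le> 2 * y * (p + of_int m) + g * (p + of_int m)\<^sup>2"
proof -
  have "0 \<le> of_int m * (2 * y + g * (of_int m + 2 * p))"
  proof (cases "m = 0 \<or> m \<ge> 1")
    case True
    then have "m = 0 \<or> (of_int m \<ge> (1::real))" by auto
    then show ?thesis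
    proof
      assume m: "of_int m \<ge> (1::real)"
      then have "0 \<le> of_int m + 2 * p" using assms(3) by auto
      then have "0 \<le> g * (of_int m + 2 * p)" using assms by (intro mult_nonneg_nonneg) auto
      with m assms(1) show ?thesis by (intro mult_nonneg_nonneg) linarith+
    qed simp
  next
    case False
    then have m: "of_int m \<le> (- 1::real)" by linarith
    then have "of_int m + 2 * p \<le> - 1" using assms(3) by auto
    then have "g * (of_int m + 2 * p) \<le> g * (- 1)" using assms by (intro mult_left_mono) auto
    then have "2 * y + g * (of_int m + 2 * p) \<le> 0" using assms by linarith
    with m show ?thesis by (intro mult_nonpos_nonpos) auto
  qed
  then show ?thesis by (simp add: power2_eq_square algebra_simps)
qed

lemma int_square_min:
  fixes d :: real and k :: int
  assumes "\<bar>d\<bar> \<le> 1/2"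
  shows "d\<^sup>2 \<le> (d + of_int k)\<^sup>2"
proof (cases "k = 0")
  case False
  then have "1 \<le> \<bar>real_of_int k\<bar>" by linarith
  then have "\<bar>d\<bar> \<le> \<bar>d + of_int k\<bar>" using assms by linarith
  then show ?thesis by (simp add: abs_le_square_iff)
qed simp

section \<open>The polarization and bases of its lattice\<close>

locale ppav =
  fixes Q :: "real^2 \<Rightarrow> real^2 \<Rightarrow> real" and L :: "(real^2) set"
  assumes pp: "principal_polarization Q L"
begin

lemma bilinear_Q: "bilinear Q"
  and Q_commute: "Q x y = Q y x"
  and Q_pos: "x \<noteq> 0 \<Longrightarrow> Q x x > 0"
  and Q_int: "u \<in> L \<Longrightarrow> n \<in> intpts \<Longrightarrow> Q u n \<in> \<int>"
  and lam_bij: "bij_betw (lam Q) L intpts"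
  using pp unfolding principal_polarization_def by blast+

lemmas Q_simps = bilinear_ladd[OF bilinear_Q] bilinear_radd[OF bilinear_Q]
  bilinear_lsub[OF bilinear_Q] bilinear_rsub[OF bilinear_Q]
  bilinear_lneg[OF bilinear_Q] bilinear_rneg[OF bilinear_Q]
  bilinear_lmul[OF bilinear_Q] bilinear_rmul[OF bilinear_Q]
  bilinear_lzero[OF bilinear_Q] bilinear_rzero[OF bilinear_Q]

lemma Q_nonneg: "Q x x \<ge> 0"
  using Q_pos[of x] by (cases "x = 0") (auto simp: Q_simps)

lemma Q_cauchy_schwarz: "(Q x y)\<^sup>2 \<le> Q x x * Q y y"
proof (cases "y = 0")
  case False
  then have y: "Q y y > 0" by (rule Q_pos)
  define z where "z = Q y y *\<^sub>R x - Q x y *\<^sub>R y"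
  have "Q z z = Q y y * (Q x x * Q y y - (Q x y)\<^sup>2)"
    unfolding z_def by (simp add: Q_simps Q_commute[of y x] algebra_simps power2_eq_square)
  with Q_nonneg[of z] y show ?thesis
    by (simp add: zero_le_mult_iff)
qed (simp add: Q_simps)

lemma linear_lam: "linear (lam Q)"
  by (rule linearI) (auto simp: lam_def vec_eq_iff Q_simps)

lemma lam_inner: "lam Q u \<bullet> x = Q u x"
proof -
  have "x = (x $ 1) *\<^sub>R axis 1 1 + (x $ 2) *\<^sub>R axis 2 1"
    by (simp add: vec_eq_iff forall_2 axis_def)
  then have "Q u x = Q u ((x $ 1) *\<^sub>R axis 1 1 + (x $ 2) *\<^sub>R axis 2 1)" by simp
  also have "\<dots> = lam Q u \<bullet> x"
    by (simp add: Q_simps lam_def inner_vec_def sum_2)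
  finally show ?thesis by simp
qed

lemma inj_lam: "inj (lam Q)"
  unfolding linear_injective_0[OF linear_lam]
  using lam_inner Q_pos by (metis inner_zero_left less_irrefl)

text \<open>Only generation over the integers is asked; nondegeneracy is recovered from the
  polarization in \<open>zbasis_orthogonal_eq_0\<close>.\<close>

definition zbasis :: "real^2 \<Rightarrow> real^2 \<Rightarrow> bool" where
  "zbasis u v \<longleftrightarrow> L = {of_int a *\<^sub>R u + of_int c *\<^sub>R v | a c. True}"

lemma zbasis_exists: "\<exists>u v. zbasis u v"
  using pp unfolding principal_polarization_def full_lattice_def zbasis_def by blast

lemma zbasisI:
  assumes "\<And>x. x \<in> L \<Longrightarrow> \<exists>a c. x = of_int a *\<^sub>R u + of_int c *\<^sub>R v"
    and "\<And>a c. of_int a *\<^sub>R u + of_int c *\<^sub>R v \<in> L"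
  shows "zbasis u v"
  unfolding zbasis_def using assms by blast

lemma zbasisE:
  assumes "zbasis u v" and "x \<in> L"
  obtains a c where "x = of_int a *\<^sub>R u + of_int c *\<^sub>R v"
  using assms unfolding zbasis_def by blast

lemma zbasis_mem: "zbasis u v \<Longrightarrow> of_int a *\<^sub>R u + of_int c *\<^sub>R v \<in> L"
  unfolding zbasis_def by blast

lemma zbasis_in_L:
  assumes "zbasis u v" shows "u \<in> L" "v \<in> L"
  using zbasis_mem[OF assms, of 1 0] zbasis_mem[OF assms, of 0 1] by auto

lemma L_zero: "0 \<in> L"
  and L_add: "x \<in> L \<Longrightarrow> y \<in> L \<Longrightarrow> x + y \<in> L"
  and L_uminus: "x \<in> L \<Longrightarrow> - x \<in> L"
proof -
  obtain u v where uv: "zbasis u v" using zbasis_exists by blast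
  show "0 \<in> L" using zbasis_mem[OF uv, of 0 0] by simp
  show "x + y \<in> L" if xy: "x \<in> L" "y \<in> L"
  proof -
    obtain a c where x: "x = of_int a *\<^sub>R u + of_int c *\<^sub>R v" using uv xy(1) zbasisE by blast
    obtain a' c' where y: "y = of_int a' *\<^sub>R u + of_int c' *\<^sub>R v" using uv xy(2) zbasisE by blast
    show ?thesis
      using zbasis_mem[OF uv, of "a + a'" "c + c'"] unfolding x y by (simp add: algebra_simps)
  qed
  show "- x \<in> L" if x: "x \<in> L"
  proof -
    obtain a c where "x = of_int a *\<^sub>R u + of_int c *\<^sub>R v" using uv x zbasisE by blast
    then show ?thesis using zbasis_mem[OF uv, of "- a" "- c"] by (simp add: algebra_simps)
  qed
qed

lemma L_diff: "x \<in> L \<Longrightarrow> y \<in> L \<Longrightarrow> x - y \<in> L"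
  using L_add[of x "- y"] L_uminus by simp

lemma zbasis_swap: assumes "zbasis u v" shows "zbasis v u"
proof (rule zbasisI)
  fix x assume "x \<in> L"
  then obtain a c where "x = of_int a *\<^sub>R u + of_int c *\<^sub>R v" using assms zbasisE by blast
  then show "\<exists>a c. x = of_int a *\<^sub>R v + of_int c *\<^sub>R u" using add.commute by blast
next
  fix a c
  show "of_int a *\<^sub>R v + of_int c *\<^sub>R u \<in> L"
    using zbasis_mem[OF assms, of c a] by (simp add: add.commute)
qed

lemma zbasis_uminus: assumes "zbasis u v" shows "zbasis u (- v)"
proof (rule zbasisI)
  fix x assume "x \<in> L"
  then obtain a c where "x = of_int a *\<^sub>R u + of_int c *\<^sub>R v" using assms zbasisE by blast
  then show "\<exists>a c. x = of_int a *\<^sub>R u + of_int c *\<^sub>R - v"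
    by (intro exI[of _ a] exI[of _ "- c"]) simp
next
  fix a c
  show "of_int a *\<^sub>R u + of_int c *\<^sub>R - v \<in> L"
    using zbasis_mem[OF assms, of a "- c"] by simp
qed

lemma zbasis_add: assumes "zbasis u v" shows "zbasis u (u + v)"
proof (rule zbasisI)
  fix x assume "x \<in> L"
  then obtain a c where "x = of_int a *\<^sub>R u + of_int c *\<^sub>R v" using assms zbasisE by blast
  then show "\<exists>a c. x = of_int a *\<^sub>R u + of_int c *\<^sub>R (u + v)"
    by (intro exI[of _ "a - c"] exI[of _ c]) (simp add: algebra_simps)
next
  fix a c
  show "of_int a *\<^sub>R u + of_int c *\<^sub>R (u + v) \<in> L"
    using zbasis_mem[OF assms, of "a + c" c] by (simp add: algebra_simps)
qed

text \<open>Principality makes each coordinate functional equal to \<open>Q w\<close> for some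
  \<open>w\<close> in \<open>L\<close>, hence an integer combination of \<open>Q u\<close> and
  \<open>Q v\<close>.\<close>

lemma zbasis_orthogonal_eq_0:
  assumes uv: "zbasis u v" and "Q u x = 0" "Q v x = 0"
  shows "x = 0"
proof -
  have "x $ i = 0" for i
  proof -
    have "(axis i 1 :: real^2) \<in> intpts" by (simp add: intpts_def axis_def)
    then obtain w where w: "w \<in> L" "lam Q w = axis i 1"
      using lam_bij unfolding bij_betw_def by (metis imageE)
    obtain a c where "w = of_int a *\<^sub>R u + of_int c *\<^sub>R v" using uv w(1) zbasisE by blast
    then have "Q w x = 0" using assms by (simp add: Q_simps)
    then show ?thesis using lam_inner[of w x] w(2) by (simp add: inner_axis')
  qed
  then show ?thesis by (simp add: vec_eq_iff)
qed

section \<open>Discreteness and attained minima\<close>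

text \<open>The components of \<open>lam Q u\<close> are integers, bounded by Cauchy-Schwarz once
  \<open>Q u u\<close> is, and \<open>lam Q\<close> is injective.\<close>

lemma finite_lattice_sublevel: "finite {u \<in> L. Q (z + u) (z + u) \<le> R}"
proof -
  define K where "K = (2 * R + 2 * Q z z)"
  define e :: "2 \<Rightarrow> real^2" where "e i = axis i 1" for i
  define B where "B i = {k \<in> \<int>. \<bar>k\<bar> \<le> sqrt (K * Q (e i) (e i))}" for i
  let ?S = "{u \<in> L. Q (z + u) (z + u) \<le> R}"
  have sub: "(\<lambda>u. (lam Q u $ 1, lam Q u $ 2)) ` ?S \<subseteq> B 1 \<times> B 2"
  proof -
    have "lam Q u $ i \<in> B i" if u: "u \<in> ?S" for u i
    proof -
      \<comment> \<open>Expanding gives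
        \<open>Q u u \<le> 2 * Q (z + u) (z + u) + 2 * Q z z\<close>, the source of
        \<open>K\<close>.\<close>
      have "0 \<le> Q (2 *\<^sub>R z + u) (2 *\<^sub>R z + u)" by (rule Q_nonneg)
      then have "Q u u \<le> K" using u unfolding K_def
        by (simp add: Q_simps Q_commute[of u z])
      then have "(Q u (e i))\<^sup>2 \<le> K * Q (e i) (e i)"
        using Q_cauchy_schwarz[of u "e i"] mult_right_mono[OF _ Q_nonneg[of "e i"]] by (meson order_trans)
      then have "\<bar>Q u (e i)\<bar> \<le> sqrt (K * Q (e i) (e i))" by (rule real_le_rsqrt[OF order_trans[rotated]]) simp
      moreover have "Q u (e i) \<in> \<int>"
        using u by (intro Q_int) (auto simp: e_def intpts_def axis_def)
      ultimately show ?thesis by (simp add: B_def lam_def e_def)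
    qed
    then show ?thesis by blast
  qed
  have "inj_on (\<lambda>u. (lam Q u $ 1, lam Q u $ 2)) ?S"
    by (rule inj_onI, rule injD[OF inj_lam]) (simp add: vec_eq_iff[of "lam Q _"] forall_2)
  moreover have "finite (B 1 \<times> B 2)" unfolding B_def by (intro finite_cartesian_product finite_abs_int_segment)
  ultimately show ?thesis using sub by (meson finite_imageD finite_subset)
qed

lemma lattice_minimum_exists: "\<exists>u\<in>L. \<forall>v\<in>L. Q (z + u) (z + u) \<le> Q (z + v) (z + v)"
proof -
  define S where "S = {u \<in> L. Q (z + u) (z + u) \<le> Q z z}"
  have S: "finite S" "S \<noteq> {}"
    unfolding S_def using finite_lattice_sublevel L_zero by auto
  from ex_min_if_finite[of "(\<lambda>u. Q (z + u) (z + u)) ` S"] S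
  obtain u where u: "u \<in> S" "\<And>v. v \<in> S \<Longrightarrow> Q (z + u) (z + u) \<le> Q (z + v) (z + v)"
    by (auto simp: not_less)
  have "Q (z + u) (z + u) \<le> Q (z + v) (z + v)" if "v \<in> L" for v
    using u(1) u(2)[of v] that by (cases "v \<in> S") (auto simp: S_def)
  with u(1) show ?thesis by (auto simp: S_def)
qed

section \<open>Theta functions as distances to the lattice\<close>

text \<open>This is the squared \<open>Q\<close>-distance from \<open>z\<close> to \<open>L\<close>,
  since \<open>L = - L\<close>.\<close>

definition G :: "real^2 \<Rightarrow> real" where
  "G z = (INF u\<in>L. Q (z + u) (z + u))"

lemma INF_lattice_eqI:
  assumes "u \<in> L" "\<And>v. v \<in> L \<Longrightarrow> f u \<le> (f v :: real)"
  shows "(INF u\<in>L. f u) = f u"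
  using assms by (intro cInf_eq_minimum) auto

lemma G_periodic: assumes "u \<in> L" shows "G (z + u) = G z"
proof -
  have "(\<lambda>v. Q (z + u + v) (z + u + v)) ` L = (\<lambda>v. Q (z + v) (z + v)) ` L" (is "?f ` L = ?g ` L")
  proof (intro equalityI image_subsetI)
    fix v assume v: "v \<in> L"
    show "?f v \<in> ?g ` L"
      using L_add[OF assms v] by (intro image_eqI[of _ _ "u + v"]) (simp_all add: add.assoc)
    show "?g v \<in> ?f ` L"
      using L_diff[OF v assms] by (intro image_eqI[of _ _ "v - u"]) (simp_all add: add.assoc)
  qed
  then show ?thesis unfolding G_def by simp
qed

lemma G_cong: "z - z' \<in> L \<Longrightarrow> G z = G z'"
  using G_periodic[of "z - z'" z'] by simp

lemma G_uminus: "G (- z) = G z"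
proof -
  have *: "Q (- z + - v) (- z + - v) = Q (z + v) (z + v)" for v
    by (simp add: Q_simps)
  have "(\<lambda>v. Q (- z + v) (- z + v)) ` L = (\<lambda>v. Q (z + v) (z + v)) ` L" (is "?f ` L = ?g ` L")
  proof (intro equalityI image_subsetI)
    fix v assume v: "v \<in> L"
    show "?f v \<in> ?g ` L"
      using L_uminus[OF v] *[of "- v"] by (intro image_eqI[of _ _ "- v"]) simp_all
    show "?g v \<in> ?f ` L"
      using L_uminus[OF v] *[of v] by (intro image_eqI[of _ _ "- v"]) simp_all
  qed
  then show ?thesis unfolding G_def by simp
qed

text \<open>Completing the square. Both infima are attained at the same \<open>u\<close>, so
  \<open>Q x x\<close> can be pulled out.\<close>

lemma theta_eq_G:
  assumes "2 *\<^sub>R lam Q c = d"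
  shows "theta Q L d x = G (x + c) - Q x x"
proof -
  have inj: "inj (\<lambda>v. 2 *\<^sub>R lam Q v)" using inj_lam by (auto simp: inj_def)
  have c: "inv (\<lambda>v. 2 *\<^sub>R lam Q v) d = c"
    using inv_f_f[OF inj, of c] assms by simp
  obtain u where u: "u \<in> L" "\<And>v. v \<in> L \<Longrightarrow> Q (x + c + u) (x + c + u) \<le> Q (x + c + v) (x + c + v)"
    using lattice_minimum_exists[of "x + c"] by blast
  have e: "2 * Q x (v + c) + Q (v + c) (v + c) = Q (x + c + v) (x + c + v) - Q x x" for v
    by (simp add: Q_simps Q_commute[of c x] Q_commute[of v x] Q_commute[of v c])
  have "theta Q L d x = Q (x + c + u) (x + c + u) - Q x x"
    unfolding theta_def c Let_def e by (rule INF_lattice_eqI) (use u in auto)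
  also have "Q (x + c + u) (x + c + u) = G (x + c)"
    unfolding G_def by (rule INF_lattice_eqI[symmetric]) (use u in auto)
  finally show ?thesis .
qed

section \<open>Reducibility from an orthogonal basis\<close>

text \<open>The pairings with \<open>u\<close> and \<open>v\<close> are the product coordinates:
  \<open>lam Q\<close> carries the basis of \<open>L\<close> to one of \<open>M\<close>, so integer
  points correspond, and orthogonality diagonalises both lattice and form.\<close>

lemma orthogonal_zbasis_reducible:
  assumes uv: "zbasis u v" and orth: "Q u v = 0"
  shows "reducible_pav Q L"
proof -
  define \<phi> :: "real^2 \<Rightarrow> real^2" where "\<phi> x = vector [Q u x, Q v x]" for x
  have \<phi>1 [simp]: "\<phi> x $ 1 = Q u x" and \<phi>2 [simp]: "\<phi> x $ 2 = Q v x" for x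
    by (simp_all add: \<phi>_def)
  have lin: "linear \<phi>"
    by (rule linearI) (auto simp: vec_eq_iff forall_2 Q_simps)
  have inj: "inj \<phi>"
    unfolding linear_injective_0[OF lin] by (metis \<phi>1 \<phi>2 zbasis_orthogonal_eq_0[OF uv] zero_index)
  have surj: "surj \<phi>" using linear_injective_imp_surjective[OF lin inj] by simp
  \<comment> \<open>A generating pair could a priori contain zero; surjectivity of \<phi> rules this
    out.\<close>
  have u0: "u \<noteq> 0"
  proof
    assume "u = 0"
    obtain x where "\<phi> x = vector [1, 0]" using surj by (metis surjD)
    then have "Q u x = 1" by (metis \<phi>1 vector_2(1))
    with \<open>u = 0\<close> show False by (simp add: Q_simps)
  qed
  have v0: "v \<noteq> 0"
  proof
    assume "v = 0"
    obtain x where "\<phi> x = vector [0, 1]" using surj by (metis surjD)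
    then have "Q v x = 1" by (metis \<phi>2 vector_2(2))
    with \<open>v = 0\<close> show False by (simp add: Q_simps)
  qed
  note pos = Q_pos[OF u0] Q_pos[OF v0]
  have orth': "Q v u = 0" using orth Q_commute by metis
  have int: "\<phi> ` intpts = intpts"
  proof (intro equalityI subsetI)
    fix y assume "y \<in> \<phi> ` intpts"
    then show "y \<in> intpts"
      using Q_int zbasis_in_L[OF uv] by (auto simp: intpts_def forall_2)
  next
    fix m assume m: "m \<in> intpts"
    obtain n where n: "m = \<phi> n" using surj by (metis surjD)
    have "n $ i \<in> \<int>" for i
    proof -
      have "(axis i 1 :: real^2) \<in> intpts" by (simp add: intpts_def axis_def)
      then obtain w where w: "w \<in> L" "lam Q w = axis i 1"
        using lam_bij unfolding bij_betw_def by (metis imageE)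
      obtain a c where "w = of_int a *\<^sub>R u + of_int c *\<^sub>R v" using uv w(1) zbasisE by blast
      then have "Q w n = of_int a * m $ 1 + of_int c * m $ 2" by (simp add: Q_simps n)
      also have "\<dots> \<in> \<int>" using m by (auto simp: intpts_def)
      finally show ?thesis using lam_inner[of w n] w(2) by (simp add: inner_axis')
    qed
    then show "m \<in> \<phi> ` intpts" using n by (auto simp: intpts_def)
  qed
  have lat: "\<phi> ` L = {vector [of_int a * Q u u, of_int c * Q v v] | a c. True}"
  proof -
    have "\<phi> (of_int a *\<^sub>R u + of_int c *\<^sub>R v) = vector [of_int a * Q u u, of_int c * Q v v]" for a c
      by (simp add: \<phi>_def Q_simps orth orth')
    then show ?thesis using uv unfolding zbasis_def by (force simp: image_iff)
  qed
  have form: "Q x y = (1 / Q u u) * (\<phi> x $ 1) * (\<phi> y $ 1) + (1 / Q v v) * (\<phi> x $ 2) * (\<phi> y $ 2)" for x y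
  proof -
    \<comment> \<open>\<open>r\<close> is what remains of \<open>x\<close> after its
      \<open>Q\<close>-orthogonal projections to \<open>u\<close> and \<open>v\<close> are
      removed.\<close>
    define r where "r = x - (Q u x / Q u u) *\<^sub>R u - (Q v x / Q v v) *\<^sub>R v"
    have "r = 0"
      using pos by (intro zbasis_orthogonal_eq_0[OF uv]) (simp_all add: r_def Q_simps orth orth')
    then have "x = (Q u x / Q u u) *\<^sub>R u + (Q v x / Q v v) *\<^sub>R v" by (simp add: r_def algebra_simps)
    then have "Q x y = Q ((Q u x / Q u u) *\<^sub>R u + (Q v x / Q v v) *\<^sub>R v) y" by simp
    then show ?thesis by (simp add: Q_simps)
  qed
  show ?thesis
    unfolding reducible_pav_def
    by (intro exI[of _ \<phi>] exI[of _ "Q u u"] exI[of _ "Q v v"] exI[of _ "1 / Q u u"]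
        exI[of _ "1 / Q v v"] conjI allI lin bijI inj surj int lat form) (use pos in simp_all)
qed

section \<open>Strictly obtuse superbases and the half lattice\<close>

text \<open>The asymmetric wording is stable under all permutations of the three vectors, by the
  swap lemmas below, so that one face of the box stands for all.\<close>

definition superbase :: "real^2 \<Rightarrow> real^2 \<Rightarrow> real^2 \<Rightarrow> bool" where
  "superbase w0 w1 w2 \<longleftrightarrow>
     zbasis w1 w2 \<and> w0 = - (w1 + w2) \<and> Q w0 w1 < 0 \<and> Q w0 w2 < 0 \<and> Q w1 w2 < 0"

lemma superbase_swap12:
  assumes "superbase w0 w1 w2" shows "superbase w0 w2 w1"
  using assms zbasis_swap[of w1 w2] unfolding superbase_def
  by (auto simp: add.commute Q_commute[of w2 w1])

lemma superbase_swap01: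
  assumes "superbase w0 w1 w2" shows "superbase w1 w0 w2"
proof -
  have w: "zbasis w1 w2" "w0 = - (w1 + w2)" "Q w0 w1 < 0" "Q w0 w2 < 0" "Q w1 w2 < 0"
    using assms by (auto simp: superbase_def)
  have "zbasis w2 (- (w2 + w1))" by (rule zbasis_uminus[OF zbasis_add[OF zbasis_swap[OF w(1)]]])
  then have "zbasis w2 w0" unfolding w(2) by (simp add: add.commute)
  then have "zbasis w0 w2" by (rule zbasis_swap)
  moreover have "w1 = - (w0 + w2)" unfolding w(2) by simp
  ultimately show ?thesis
    unfolding superbase_def using w(3-5) Q_commute[of w1 w0] by auto
qed

lemma superbase_rotate: "superbase w0 w1 w2 \<Longrightarrow> superbase w2 w0 w1"
  by (rule superbase_swap01[OF superbase_swap12])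

lemma superbase_exists:
  assumes "irreducible_pav Q L"
  shows "\<exists>w0 w1 w2. superbase w0 w1 w2"
proof -
  \<comment> \<open>Selling's descent: if \<open>Q u v > 0\<close>, replacing \<open>v\<close> by \<open>- v\<close> decreases \<open>S\<close>.\<close>
  define S where "S = (\<lambda>(u, v). Q u u + Q v v + Q (u + v) (u + v))"
  obtain u0 v0 where uv0: "zbasis u0 v0" using zbasis_exists by blast
  define R where "R = S (u0, v0)"
  define B where "B = {(u, v). zbasis u v \<and> S (u, v) \<le> R}"
  \<comment> \<open>Bases with \<open>S\<close> at most \<open>R\<close> use vectors from a finite
    sublevel set, so \<open>S\<close> attains its minimum over all bases.\<close>
  have "B \<subseteq> {u \<in> L. Q (0 + u) (0 + u) \<le> R} \<times> {u \<in> L. Q (0 + u) (0 + u) \<le> R}"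
  proof clarify
    fix u v assume "(u, v) \<in> B"
    then have "zbasis u v" "Q u u + Q v v + Q (u + v) (u + v) \<le> R" by (auto simp: B_def S_def)
    with zbasis_in_L[of u v] Q_nonneg[of u] Q_nonneg[of v] Q_nonneg[of "u + v"]
    show "u \<in> {u \<in> L. Q (0 + u) (0 + u) \<le> R} \<and> v \<in> {u \<in> L. Q (0 + u) (0 + u) \<le> R}" by simp
  qed
  then have "finite B"
    by (rule finite_subset) (intro finite_cartesian_product finite_lattice_sublevel)
  moreover have "B \<noteq> {}" using uv0 by (auto simp: B_def R_def)
  ultimately obtain p where p: "p \<in> B" "\<And>q. q \<in> B \<Longrightarrow> S p \<le> S q"
    using ex_min_if_finite[of "S ` B"] by (fastforce simp: not_less)
  obtain u v where puv: "p = (u, v)" by (cases p)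
  have uv: "zbasis u v" and min: "\<And>u' v'. zbasis u' v' \<Longrightarrow> S (u, v) \<le> S (u', v')"
  proof -
    show "zbasis u v" using p(1) puv by (simp add: B_def)
    fix u' v' assume z: "zbasis u' v'"
    show "S (u, v) \<le> S (u', v')"
    proof (cases "S (u', v') \<le> R")
      case True
      then show ?thesis using p(2)[of "(u', v')"] z puv by (simp add: B_def)
    next
      case False
      then show ?thesis using p(1) puv by (simp add: B_def)
    qed
  qed
  \<comment> \<open>Stated for every minimising basis, as three pairs need it. The sign change
    alters \<open>S\<close> by \<open>- 4 * Q u' v'\<close>, and irreducibility excludes
    zero.\<close>
  have neg: "Q u' v' < 0" if z: "zbasis u' v'" and eq: "S (u', v') = S (u, v)" for u' v'
  proof -
    have "S (u', v') \<le> S (u', - v')" unfolding eq by (rule min[OF zbasis_uminus[OF z]])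
    then have "Q u' v' \<le> 0" by (simp add: S_def Q_simps Q_commute[of v' u'])
    moreover have "Q u' v' \<noteq> 0"
      using assms orthogonal_zbasis_reducible[OF z] unfolding irreducible_pav_def by blast
    ultimately show ?thesis by simp
  qed
  \<comment> \<open>\<open>S\<close> is the sum of the norms of \<open>u\<close>, \<open>v\<close>
    and \<open>w\<close>, hence takes the same value on \<open>(u, w)\<close> and
    \<open>(v, w)\<close>.\<close>
  define w where "w = - (u + v)"
  have "zbasis u w" unfolding w_def using zbasis_add[OF uv] by (rule zbasis_uminus)
  then have 1: "Q u w < 0"
    by (rule neg) (simp add: S_def w_def Q_simps)
  have "zbasis v w" unfolding w_def using zbasis_uminus[OF zbasis_add[OF zbasis_swap[OF uv]]]
    by (simp add: add.commute)
  then have 2: "Q v w < 0"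
    by (rule neg) (simp add: S_def w_def Q_simps)
  have "superbase w u v"
    unfolding superbase_def using uv neg[OF uv] 1 2 w_def Q_commute[of w u] Q_commute[of w v] by auto
  then show ?thesis by blast
qed


lemma superbase_mem:
  assumes "superbase w0 w1 w2" shows "w0 \<in> L" "w1 \<in> L" "w2 \<in> L"
proof -
  show "w1 \<in> L" "w2 \<in> L" using assms zbasis_in_L unfolding superbase_def by blast+
  then show "w0 \<in> L" using assms L_uminus[OF L_add] unfolding superbase_def by blast
qed

lemma superbase_half:
  assumes "superbase w0 w1 w2"
  shows "x + (1/2) *\<^sub>R w0 = x - (1/2) *\<^sub>R w1 - (1/2) *\<^sub>R w2"
    "x - (1/2) *\<^sub>R w0 = x + (1/2) *\<^sub>R w1 + (1/2) *\<^sub>R w2"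
proof -
  have w0: "w0 = - (w1 + w2)" using assms by (simp add: superbase_def)
  show "x + (1/2) *\<^sub>R w0 = x - (1/2) *\<^sub>R w1 - (1/2) *\<^sub>R w2"
    "x - (1/2) *\<^sub>R w0 = x + (1/2) *\<^sub>R w1 + (1/2) *\<^sub>R w2"
    unfolding w0 by (simp_all add: algebra_simps)
qed

lemma superbase_norms:
  assumes "superbase w0 w1 w2"
  shows "Q w1 w1 = - Q w1 w2 - Q w0 w1" "Q w2 w2 = - Q w1 w2 - Q w0 w2"
    "Q w0 w0 = - Q w0 w1 - Q w0 w2" "Q x w0 = - Q x w1 - Q x w2"
proof -
  have w0: "w0 = - (w1 + w2)" using assms by (simp add: superbase_def)
  show "Q w1 w1 = - Q w1 w2 - Q w0 w1" "Q w2 w2 = - Q w1 w2 - Q w0 w2"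
    "Q w0 w0 = - Q w0 w1 - Q w0 w2" "Q x w0 = - Q x w1 - Q x w2"
    unfolding w0 by (simp_all add: Q_simps Q_commute[of w2 w1])
qed

text \<open>\<open>D\<close> is the determinant of the Gram matrix of \<open>w1\<close> and
  \<open>w2\<close>; \<open>m\<close> and \<open>n\<close> come from Cramer's rule.\<close>

lemma superbase_solve:
  assumes sb: "superbase w0 w1 w2"
  shows "\<exists>x. Q x w1 = s \<and> Q x w2 = t"
proof -
  define \<alpha> where "\<alpha> = - Q w1 w2"
  define \<beta> where "\<beta> = - Q w0 w2"
  define \<gamma> where "\<gamma> = - Q w0 w1"
  have pos: "\<alpha> > 0" "\<beta> > 0" "\<gamma> > 0"
    using sb by (auto simp: superbase_def \<alpha>_def \<beta>_def \<gamma>_def)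
  have Qs: "Q w1 w1 = \<alpha> + \<gamma>" "Q w2 w2 = \<alpha> + \<beta>" "Q w1 w2 = - \<alpha>" "Q w2 w1 = - \<alpha>"
    using superbase_norms[OF sb] Q_commute[of w2 w1] by (auto simp: \<alpha>_def \<beta>_def \<gamma>_def)
  define D where "D = \<alpha> * \<beta> + \<beta> * \<gamma> + \<gamma> * \<alpha>"
  have D: "D > 0" unfolding D_def using pos by (simp add: add_pos_pos)
  define m where "m = ((\<alpha> + \<beta>) * s + \<alpha> * t) / D"
  define n where "n = (\<alpha> * s + (\<alpha> + \<gamma>) * t) / D"
  have "Q (m *\<^sub>R w1 + n *\<^sub>R w2) w1 = (m * D * (\<alpha> + \<gamma>) - n * D * \<alpha>) / D"
    "Q (m *\<^sub>R w1 + n *\<^sub>R w2) w2 = (n * D * (\<alpha> + \<beta>) - m * D * \<alpha>) / D"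
    using D by (simp_all add: Q_simps Qs field_simps)
  moreover have "m * D = (\<alpha> + \<beta>) * s + \<alpha> * t" "n * D = \<alpha> * s + (\<alpha> + \<gamma>) * t"
    using D by (simp_all add: m_def n_def)
  moreover have "((\<alpha> + \<beta>) * s + \<alpha> * t) * (\<alpha> + \<gamma>) - (\<alpha> * s + (\<alpha> + \<gamma>) * t) * \<alpha> = s * D"
    "(\<alpha> * s + (\<alpha> + \<gamma>) * t) * (\<alpha> + \<beta>) - ((\<alpha> + \<beta>) * s + \<alpha> * t) * \<alpha> = t * D"
    by (simp_all add: D_def algebra_simps)
  ultimately have "Q (m *\<^sub>R w1 + n *\<^sub>R w2) w1 = s \<and> Q (m *\<^sub>R w1 + n *\<^sub>R w2) w2 = t"
    using D by simp
  then show ?thesis by blast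
qed

text \<open>The parities of the two coefficients give the four classes of the half lattice modulo
  \<open>L\<close>.\<close>

lemma half_lattice_cases:
  assumes sb: "superbase w0 w1 w2" and "u \<in> L"
  obtains h where "h \<in> {0, w0, w1, w2}" "(1/2) *\<^sub>R u - (1/2) *\<^sub>R h \<in> L"
proof -
  have zb: "zbasis w1 w2" and w0: "w0 = - (w1 + w2)" using sb by (auto simp: superbase_def)
  obtain m n where u: "u = of_int m *\<^sub>R w1 + of_int n *\<^sub>R w2" using zb assms(2) zbasisE by blast
  define k l where "k = m div 2" and "l = n div 2"
  have m: "m = 2 * k \<or> m = 2 * k + 1" and n: "n = 2 * l \<or> n = 2 * l + 1"
    unfolding k_def l_def by presburger+
  note mem = zbasis_mem[OF zb, of k l] zbasis_mem[OF zb, of "k + 1" "l + 1"]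
  show thesis
  proof (cases "m = 2 * k"; cases "n = 2 * l")
    assume "m = 2 * k" "n = 2 * l"
    then show thesis using mem(1) by (intro that[of 0]) (auto simp: u algebra_simps)
  next
    assume "m = 2 * k" "n \<noteq> 2 * l"
    then show thesis using mem(1) n by (intro that[of w2]) (auto simp: u algebra_simps)
  next
    assume "m \<noteq> 2 * k" "n = 2 * l"
    then show thesis using mem(1) m by (intro that[of w1]) (auto simp: u algebra_simps)
  next
    assume "m \<noteq> 2 * k" "n \<noteq> 2 * l"
    then have mn: "m = 2 * k + 1" "n = 2 * l + 1" using m n by auto
    \<comment> \<open>Since \<open>w0\<close> is minus the sum of \<open>w1\<close> and
      \<open>w2\<close>, odd coefficients round up.\<close>
    have "(1/2) *\<^sub>R u - (1/2) *\<^sub>R w0 = of_int (k + 1) *\<^sub>R w1 + of_int (l + 1) *\<^sub>R w2"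
      unfolding u mn w0 by (simp add: vec_eq_iff field_simps)
    then show thesis using mem(2) by (intro that[of w0]) auto
  qed
qed

section \<open>Hadamard coordinates under half-lattice translations\<close>

text \<open>Pairing of the four values of \<open>G\<close> with the character of the half lattice
  modulo \<open>L\<close> that is \<open>1\<close> on half of the first vector and
  \<open>- 1\<close> on halves of the other two. The signs sum to zero, so the summand
  \<open>Q x x\<close> cancels.\<close>

definition had :: "real^2 \<Rightarrow> real^2 \<Rightarrow> real^2 \<Rightarrow> real^2 \<Rightarrow> real" where
  "had w0 w1 w2 x =
     G x + G (x + (1/2) *\<^sub>R w0) - G (x + (1/2) *\<^sub>R w1) - G (x + (1/2) *\<^sub>R w2)"

lemma had_swap: "had w0 w2 w1 = had w0 w1 w2"
  by (simp add: had_def fun_eq_iff)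

lemma G_minus_half: "w \<in> L \<Longrightarrow> G (x - (1/2) *\<^sub>R w) = G (x + (1/2) *\<^sub>R w)"
  by (rule G_cong) (use L_uminus in \<open>simp flip: scaleR_add_left\<close>)

lemma had_uminus:
  assumes "superbase w0 w1 w2" shows "had w0 w1 w2 (- x) = had w0 w1 w2 x"
proof -
  have "G (- x + (1/2) *\<^sub>R w) = G (x + (1/2) *\<^sub>R w)" if "w \<in> L" for w
    using G_uminus[of "x - (1/2) *\<^sub>R w"] G_minus_half[OF that] by simp
  then show ?thesis using superbase_mem[OF assms] by (simp add: had_def G_uminus)
qed

lemma had_periodic: "u \<in> L \<Longrightarrow> had w0 w1 w2 (x + u) = had w0 w1 w2 x"
proof -
  assume "u \<in> L"
  then have "G (x + u + v) = G (x + v)" for v using G_periodic[of u "x + v"] by (simp add: ac_simps)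
  from this[of 0] this show ?thesis by (simp add: had_def)
qed

text \<open>The addition table of the Klein group of half-lattice classes: halves of
  \<open>w1\<close> and \<open>w2\<close> add up to minus half of \<open>w0\<close>, which modulo
  \<open>L\<close> is half of \<open>w0\<close>.\<close>

lemma G_half_half:
  assumes "superbase w0 w1 w2"
  shows "G (x + (1/2) *\<^sub>R w1 + (1/2) *\<^sub>R w2) = G (x + (1/2) *\<^sub>R w0)"
    "G (x + (1/2) *\<^sub>R w1 + (1/2) *\<^sub>R w1) = G x"
proof -
  show "G (x + (1/2) *\<^sub>R w1 + (1/2) *\<^sub>R w2) = G (x + (1/2) *\<^sub>R w0)"
    using G_minus_half[OF superbase_mem(1)[OF assms], of x] unfolding superbase_half(2)[OF assms] .
  show "G (x + (1/2) *\<^sub>R w1 + (1/2) *\<^sub>R w1) = G x"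
    by (rule G_cong) (use superbase_mem(2)[OF assms] in \<open>simp flip: scaleR_add_left\<close>)
qed

lemma had_half_fixed:
  assumes "superbase w0 w1 w2"
  shows "had w0 w1 w2 (x + (1/2) *\<^sub>R w0) = had w0 w1 w2 x"
  using G_half_half[OF superbase_swap01[OF assms], of x]
    G_half_half[OF superbase_swap12[OF superbase_swap01[OF superbase_swap12[OF assms]]], of x]
    G_half_half(1)[OF superbase_swap12[OF superbase_swap01[OF assms]], of x]
  by (simp add: had_def ac_simps)

text \<open>Adding half of \<open>w1\<close> exchanges the terms of \<open>0\<close> and
  \<open>w1\<close> and those of \<open>w0\<close> and \<open>w2\<close>; each exchange pairs a plus
  sign with a minus sign.\<close>

lemma had_half_flipped:
  assumes "superbase w0 w1 w2"
  shows "had w0 w1 w2 (x + (1/2) *\<^sub>R w1) = - had w0 w1 w2 x"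
    "had w0 w1 w2 (x + (1/2) *\<^sub>R w2) = - had w0 w1 w2 x"
proof -
  have *: "had w0 w1 w2 (x + (1/2) *\<^sub>R w1) = - had w0 w1 w2 x" if "superbase w0 w1 w2" for w0 w1 w2
    using G_half_half[OF that, of x] G_half_half(1)[OF superbase_swap12[OF superbase_swap01[OF superbase_swap12[OF that]]], of x]
    by (simp add: had_def ac_simps)
  show "had w0 w1 w2 (x + (1/2) *\<^sub>R w1) = - had w0 w1 w2 x" by (rule *[OF assms])
  show "had w0 w1 w2 (x + (1/2) *\<^sub>R w2) = - had w0 w1 w2 x"
    using *[OF superbase_swap12[OF assms]] by (simp add: had_swap)
qed

lemma abs_had_half:
  assumes sb: "superbase w0 w1 w2" and u: "u \<in> L"
  shows "\<bar>had w0 w1 w2 (x + (1/2) *\<^sub>R u)\<bar> = \<bar>had w0 w1 w2 x\<bar>"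
proof -
  obtain h where h: "h \<in> {0, w0, w1, w2}" "(1/2) *\<^sub>R u - (1/2) *\<^sub>R h \<in> L"
    using half_lattice_cases[OF sb u] .
  have "had w0 w1 w2 (x + (1/2) *\<^sub>R u) = had w0 w1 w2 (x + (1/2) *\<^sub>R h)"
    using had_periodic[OF h(2), of w0 w1 w2 "x + (1/2) *\<^sub>R h"] by simp
  then show ?thesis
    using h(1) had_half_fixed[OF sb] had_half_flipped[OF sb] by auto
qed

section \<open>Affine formulas on the fundamental parallelogram\<close>

text \<open>In Selling's form the quadratic part is a positive combination of squares of \<open>p\<close>, \<open>q\<close> and
  \<open>p - q\<close>, so that the three summands can be minimised separately.\<close>
lemma G_on_face:
  assumes sb: "superbase w0 w1 w2"
    and y1: "0 \<le> 2 * Q x w1" "2 * Q x w1 \<le> - Q w0 w1"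
    and y2: "0 \<le> 2 * Q x w2" "2 * Q x w2 \<le> - Q w0 w2"
    and pq: "p \<in> {0, - 1/2}" "q \<in> {0, - 1/2}"
  shows "G (x + p *\<^sub>R w1 + q *\<^sub>R w2) =
    Q x x + (2 * Q x w1 * p + (- Q w0 w1) * p\<^sup>2) + (2 * Q x w2 * q + (- Q w0 w2) * q\<^sup>2)
      + (- Q w1 w2) * (p - q)\<^sup>2"
proof -
  have zb: "zbasis w1 w2" and neg: "Q w1 w2 < 0" using sb by (auto simp: superbase_def)
  define f where "f p q = Q x x + (2 * Q x w1 * p + (- Q w0 w1) * p\<^sup>2)
      + (2 * Q x w2 * q + (- Q w0 w2) * q\<^sup>2) + (- Q w1 w2) * (p - q)\<^sup>2" for p q
  have f: "Q (x + p *\<^sub>R w1 + q *\<^sub>R w2) (x + p *\<^sub>R w1 + q *\<^sub>R w2) = f p q" for p q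
    unfolding f_def
    by (simp add: Q_simps Q_commute[of w1 x] Q_commute[of w2 x] Q_commute[of w2 w1]
        superbase_norms(1,2)[OF sb] power2_eq_square algebra_simps)
  have "Q (x + p *\<^sub>R w1 + q *\<^sub>R w2 + 0) (x + p *\<^sub>R w1 + q *\<^sub>R w2 + 0) \<le>
        Q (x + p *\<^sub>R w1 + q *\<^sub>R w2 + u) (x + p *\<^sub>R w1 + q *\<^sub>R w2 + u)" if u: "u \<in> L" for u
  proof -
    obtain m n where u: "u = of_int m *\<^sub>R w1 + of_int n *\<^sub>R w2" using zb u zbasisE by blast
    have eq: "x + p *\<^sub>R w1 + q *\<^sub>R w2 + u = x + (p + of_int m) *\<^sub>R w1 + (q + of_int n) *\<^sub>R w2"
      by (simp add: u algebra_simps)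
    \<comment> \<open>\<open>p - q\<close> is \<open>0\<close> or \<open>1/2\<close> in absolute
      value, so no integer shift brings it closer to zero.\<close>
    have "(p - q)\<^sup>2 \<le> (p - q + of_int (m - n))\<^sup>2"
      using pq by (intro int_square_min) auto
    then have "(- Q w1 w2) * (p - q)\<^sup>2 \<le> (- Q w1 w2) * (p + of_int m - (q + of_int n))\<^sup>2"
      using neg by (intro mult_left_mono) (auto simp: algebra_simps)
    then have "f p q \<le> f (p + of_int m) (q + of_int n)"
      unfolding f_def
      using int_quadratic_min[OF y1 pq(1), of m] int_quadratic_min[OF y2 pq(2), of n] by linarith
    then show ?thesis unfolding eq by (simp add: f)
  qed
  then have "G (x + p *\<^sub>R w1 + q *\<^sub>R w2) = Q (x + p *\<^sub>R w1 + q *\<^sub>R w2 + 0) (x + p *\<^sub>R w1 + q *\<^sub>R w2 + 0)"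
    unfolding G_def by (intro INF_lattice_eqI L_zero)
  then show ?thesis by (simp add: f f_def)
qed

text \<open>\<open>G_on_face\<close> covers all four values of \<open>G\<close> at the same
  \<open>x\<close>, so the quadratic part cancels and the coordinates are affine on the
  parallelogram.\<close>

lemma had_on_face:
  assumes sb: "superbase w0 w1 w2"
    and y1: "0 \<le> 2 * Q x w1" "2 * Q x w1 \<le> - Q w0 w1"
    and y2: "0 \<le> 2 * Q x w2" "2 * Q x w2 \<le> - Q w0 w2"
  shows "had w0 w1 w2 x = Q w1 w2 / 2"
    "had w1 w0 w2 x = Q w0 w2 / 2 + 2 * Q x w2"
    "had w2 w0 w1 x = Q w0 w1 / 2 + 2 * Q x w1"
proof -
  note G = G_on_face[OF sb y1 y2]
  have 0: "G x = Q x x" using G[of 0 0] by simp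
  have 1: "G (x + (1/2) *\<^sub>R w1) = Q x x - Q x w1 - Q w0 w1 / 4 - Q w1 w2 / 4"
    using G[of "- 1/2" 0] G_minus_half[of w1 x] superbase_mem[OF sb] by (simp add: power2_eq_square)
  have 2: "G (x + (1/2) *\<^sub>R w2) = Q x x - Q x w2 - Q w0 w2 / 4 - Q w1 w2 / 4"
    using G[of 0 "- 1/2"] G_minus_half[of w2 x] superbase_mem[OF sb] by (simp add: power2_eq_square)
  have 3: "G (x + (1/2) *\<^sub>R w0) = Q x x - Q x w1 - Q w0 w1 / 4 - Q x w2 - Q w0 w2 / 4"
    unfolding superbase_half(1)[OF sb] using G[of "- 1/2" "- 1/2"] by (simp add: power2_eq_square)
  show "had w0 w1 w2 x = Q w1 w2 / 2"
    "had w1 w0 w2 x = Q w0 w2 / 2 + 2 * Q x w2"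
    "had w2 w0 w1 x = Q w0 w1 / 2 + 2 * Q x w1"
    unfolding had_def 0 1 2 3 by simp_all
qed

section \<open>The image lies on the surface of the box\<close>

text \<open>Absolute values make the condition invariant under the sign changes caused by
  half-lattice translations.\<close>

definition on_box :: "real^2 \<Rightarrow> real^2 \<Rightarrow> real^2 \<Rightarrow> real^2 \<Rightarrow> bool" where
  "on_box w0 w1 w2 x \<longleftrightarrow>
     \<bar>had w0 w1 w2 x\<bar> \<le> - Q w1 w2 / 2 \<and> \<bar>had w1 w0 w2 x\<bar> \<le> - Q w0 w2 / 2 \<and>
     \<bar>had w2 w0 w1 x\<bar> \<le> - Q w0 w1 / 2 \<and>
     (\<bar>had w0 w1 w2 x\<bar> = - Q w1 w2 / 2 \<or> \<bar>had w1 w0 w2 x\<bar> = - Q w0 w2 / 2 \<or>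
      \<bar>had w2 w0 w1 x\<bar> = - Q w0 w1 / 2)"

lemma on_box_swap12: "on_box w0 w2 w1 x = on_box w0 w1 w2 x"
  unfolding on_box_def using had_swap Q_commute[of w2 w1] by auto

lemma on_box_swap01: "on_box w1 w0 w2 x = on_box w0 w1 w2 x"
  unfolding on_box_def had_swap[of w2 w0 w1] Q_commute[of w1 w0] by blast

lemma on_box_rotate: "on_box w2 w0 w1 x = on_box w0 w1 w2 x"
  by (simp add: on_box_swap01[of w0 w2] on_box_swap12[of w0 w1])

lemma on_box_half:
  assumes sb: "superbase w0 w1 w2" and u: "u \<in> L"
  shows "on_box w0 w1 w2 (x + (1/2) *\<^sub>R u) = on_box w0 w1 w2 x"
  unfolding on_box_def
  using abs_had_half[OF sb u] abs_had_half[OF superbase_swap01[OF sb] u]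
    abs_had_half[OF superbase_rotate[OF sb] u] by simp

lemma on_box_uminus:
  assumes sb: "superbase w0 w1 w2"
  shows "on_box w0 w1 w2 (- x) = on_box w0 w1 w2 x"
  unfolding on_box_def
  using had_uminus[OF sb] had_uminus[OF superbase_swap01[OF sb]]
    had_uminus[OF superbase_rotate[OF sb]] by simp

lemma on_box_face:
  assumes sb: "superbase w0 w1 w2"
    and y1: "0 \<le> 2 * Q x w1" "2 * Q x w1 \<le> - Q w0 w1"
    and y2: "0 \<le> 2 * Q x w2" "2 * Q x w2 \<le> - Q w0 w2"
  shows "on_box w0 w1 w2 x"
proof -
  have "Q w1 w2 < 0" using sb by (simp add: superbase_def)
  then show ?thesis unfolding on_box_def had_on_face[OF assms] using y1 y2 by auto
qed

text \<open>\<open>z\<close> is at least as close to \<open>0\<close> as to \<open>w\<close> and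
  \<open>- w\<close>. For the three superbase vectors together this is the hexagonal Voronoi cell of
  \<open>0\<close>.\<close>

definition reduced :: "real^2 \<Rightarrow> real^2 \<Rightarrow> bool" where
  "reduced z w \<longleftrightarrow> \<bar>2 * Q z w\<bar> \<le> Q w w"

text \<open>If \<open>z\<close> leaves the parallelogram in the direction of \<open>w\<^sub>1\<close>, then \<open>w\<^sub>1 - z\<close> lies in the one spanned
  by the other pair \<open>w\<^sub>0, w\<^sub>1\<close>.\<close>
lemma on_box_reduced_aux:
  assumes sb: "superbase w0 w1 w2"
    and red: "reduced z w0" "reduced z w1" "reduced z w2"
    and sgn: "Q z w1 \<ge> 0" "Q z w2 \<ge> 0" and le: "Q z w2 \<le> - Q w0 w2"
  shows "on_box w0 w1 w2 ((1/2) *\<^sub>R z)"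
proof (cases "Q z w1 \<le> - Q w0 w1")
  case True
  then show ?thesis using sgn le by (intro on_box_face[OF sb]) (simp_all add: Q_simps)
next
  case False
  define z' where "z' = w1 - z"
  have neg: "Q w0 w1 < 0" "Q w0 w2 < 0" "Q w1 w2 < 0" using sb by (auto simp: superbase_def)
  note n = superbase_norms[OF sb]
  have sb': "superbase w2 w0 w1" by (rule superbase_rotate[OF sb])
  have "Q z' w0 = Q w0 w1 + Q z w1 + Q z w2" "Q z' w1 = - Q w1 w2 - Q w0 w1 - Q z w1"
    unfolding z'_def using n(1) n(4)[of z] Q_commute[of w1 w0] by (simp_all add: Q_simps)
  moreover have "2 * Q z w1 + 2 * Q z w2 \<le> - Q w0 w1 - Q w0 w2"
    using red(1) n(3) n(4)[of z] unfolding reduced_def by simp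
  moreover have "2 * Q z w1 \<le> - Q w1 w2 - Q w0 w1" using red(2) n(1) unfolding reduced_def by simp
  \<comment> \<open>The lower bound for \<open>w0\<close> and the upper one for \<open>w1\<close>
    use the failed case condition; the other two use that \<open>z\<close> is reduced against
    \<open>w0\<close> and \<open>w1\<close>.\<close>
  ultimately have "on_box w2 w0 w1 ((1/2) *\<^sub>R z')"
    using False sgn neg
    by (intro on_box_face[OF sb']) (simp_all add: Q_simps Q_commute[of w2])
  moreover have "(1/2) *\<^sub>R z' = - ((1/2) *\<^sub>R z) + (1/2) *\<^sub>R w1" by (simp add: z'_def algebra_simps)
  ultimately show ?thesis
    by (simp only: on_box_rotate on_box_half[OF sb superbase_mem(2)[OF sb]] on_box_uminus[OF sb])
qed

text \<open>Reducedness against \<open>w0\<close> bounds \<open>Q z w1 + Q z w2\<close> by the mean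
  of \<open>- Q w0 w1\<close> and \<open>- Q w0 w2\<close>, so \<open>z\<close> cannot leave the
  parallelogram in both directions.\<close>

lemma on_box_reduced:
  assumes sb: "superbase w0 w1 w2"
    and red: "reduced z w0" "reduced z w1" "reduced z w2"
    and sgn: "Q z w1 \<ge> 0" "Q z w2 \<ge> 0"
  shows "on_box w0 w1 w2 ((1/2) *\<^sub>R z)"
proof (cases "Q z w2 \<le> - Q w0 w2")
  case True
  then show ?thesis using on_box_reduced_aux assms by blast
next
  case False
  have neg: "Q w0 w1 < 0" "Q w0 w2 < 0" using sb by (auto simp: superbase_def)
  have "2 * Q z w1 + 2 * Q z w2 \<le> - Q w0 w1 - Q w0 w2"
    using red(1) superbase_norms(3,4)[OF sb] unfolding reduced_def by simp
  then have "Q z w1 \<le> - Q w0 w1" using False neg sgn by linarith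
  then have "on_box w0 w2 w1 ((1/2) *\<^sub>R z)"
    using on_box_reduced_aux[OF superbase_swap12[OF sb]] red sgn by blast
  then show ?thesis by (simp add: on_box_swap12)
qed

text \<open>Doubling turns half-lattice translations into lattice translations. A shortest
  representative of \<open>2 *\<^sub>R x\<close> modulo \<open>L\<close> is reduced against every
  lattice vector, and its half differs from \<open>x\<close> by a half-lattice vector.\<close>

lemma on_box_all:
  assumes sb: "superbase w0 w1 w2"
  shows "on_box w0 w1 w2 x"
proof -
  obtain u where u: "u \<in> L" and min: "\<And>v. v \<in> L \<Longrightarrow> Q (2 *\<^sub>R x + u) (2 *\<^sub>R x + u) \<le> Q (2 *\<^sub>R x + v) (2 *\<^sub>R x + v)"
    using lattice_minimum_exists by blast
  define z where "z = 2 *\<^sub>R x + u"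
  have red: "reduced z w" if w: "w \<in> L" for w
  proof -
    have "Q z z \<le> Q (z + w) (z + w)" "Q z z \<le> Q (z - w) (z - w)"
      using min[OF L_add[OF u w]] min[OF L_diff[OF u w]] unfolding z_def by (simp_all add: algebra_simps)
    then show ?thesis unfolding reduced_def by (simp add: Q_simps Q_commute[of w z] abs_le_iff)
  qed
  then have red': "reduced (- z) w" if "w \<in> L" for w
    using that by (simp add: reduced_def Q_simps)
  note mem = superbase_mem[OF sb]
  have *: "on_box w0 w1 w2 ((1/2) *\<^sub>R y)"
    if r: "\<And>w. w \<in> L \<Longrightarrow> reduced y w"
      and y: "0 \<le> Q y w1 \<and> 0 \<le> Q y w2 \<or> 0 \<le> Q y w0 \<and> 0 \<le> Q y w2 \<or> 0 \<le> Q y w0 \<and> 0 \<le> Q y w1"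
    for y
    using y
  proof (elim disjE conjE)
    assume "0 \<le> Q y w1" "0 \<le> Q y w2"
    then show ?thesis using r mem by (intro on_box_reduced[OF sb])
  next
    assume "0 \<le> Q y w0" "0 \<le> Q y w2"
    then have "on_box w1 w0 w2 ((1/2) *\<^sub>R y)"
      using r mem by (intro on_box_reduced[OF superbase_swap01[OF sb]])
    then show ?thesis by (simp only: on_box_swap01)
  next
    assume "0 \<le> Q y w0" "0 \<le> Q y w1"
    then have "on_box w2 w0 w1 ((1/2) *\<^sub>R y)"
      using r mem by (intro on_box_reduced[OF superbase_rotate[OF sb]])
    then show ?thesis by (simp only: on_box_rotate)
  qed
  \<comment> \<open>As the three pairings sum to zero, two of them are nonnegative for
    \<open>z\<close> or for \<open>- z\<close>.\<close>
  have "Q z w0 + Q z w1 + Q z w2 = 0" "Q (- z) w = - Q z w" for w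
    using superbase_norms(4)[OF sb, of z] by (simp_all add: Q_simps)
  then have "on_box w0 w1 w2 ((1/2) *\<^sub>R z) \<or> on_box w0 w1 w2 ((1/2) *\<^sub>R (- z))"
    using *[OF red] *[OF red'] by (smt (verit))
  then have "on_box w0 w1 w2 ((1/2) *\<^sub>R z)"
    using on_box_uminus[OF sb, of "(1/2) *\<^sub>R z"] by auto
  then show ?thesis using on_box_half[OF sb u, of x] by (simp add: z_def algebra_simps)
qed

section \<open>Every point of the surface is attained\<close>

text \<open>On the lower face the formulas of \<open>had_on_face\<close> are solved for the two
  pairings; a half-lattice translation reaches the opposite face.\<close>

lemma had_onto_face:
  assumes sb: "superbase w0 w1 w2"
    and A: "\<bar>A\<bar> = - Q w1 w2 / 2" and B: "\<bar>B\<bar> \<le> - Q w0 w2 / 2" and C: "\<bar>C\<bar> \<le> - Q w0 w1 / 2"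
  shows "\<exists>x. had w0 w1 w2 x = A \<and> had w1 w0 w2 x = B \<and> had w2 w0 w1 x = C"
proof -
  have lower: "\<exists>x. had w0 w1 w2 x = Q w1 w2 / 2 \<and> had w1 w0 w2 x = B \<and> had w2 w0 w1 x = C'"
    if C': "\<bar>C'\<bar> \<le> - Q w0 w1 / 2" for C'
  proof -
    obtain x where x: "Q x w1 = (C' - Q w0 w1 / 2) / 2" "Q x w2 = (B - Q w0 w2 / 2) / 2"
      using superbase_solve[OF sb] by blast
    have "0 \<le> 2 * Q x w1" "2 * Q x w1 \<le> - Q w0 w1" "0 \<le> 2 * Q x w2" "2 * Q x w2 \<le> - Q w0 w2"
      unfolding x using B C' by auto
    from had_on_face[OF sb this] show ?thesis
      unfolding x by (intro exI[of _ x]) (simp add: field_simps)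
  qed
  show ?thesis
  proof (cases "A = Q w1 w2 / 2")
    case True
    show ?thesis unfolding True by (rule lower[OF C])
  next
    case False
    then have A': "A = - Q w1 w2 / 2" using A by linarith
    \<comment> \<open>Adding half of \<open>w1\<close> negates the first and third coordinates and
      keeps the second, hence \<open>- C\<close>.\<close>
    obtain x where x: "had w0 w1 w2 x = Q w1 w2 / 2" "had w1 w0 w2 x = B" "had w2 w0 w1 x = - C"
      using lower[of "- C"] C by auto
    have sb1: "superbase w1 w0 w2" by (rule superbase_swap01[OF sb])
    have sb2: "superbase w2 w0 w1" by (rule superbase_rotate[OF sb])
    show ?thesis
      using had_half_flipped[OF sb, of x] had_half_fixed[OF sb1, of x] had_half_flipped[OF sb2, of x] x A'
      by (intro exI[of _ "x + (1/2) *\<^sub>R w1"]) simp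
  qed
qed

lemma had_onto_box:
  assumes sb: "superbase w0 w1 w2"
    and A: "\<bar>A\<bar> \<le> - Q w1 w2 / 2" and B: "\<bar>B\<bar> \<le> - Q w0 w2 / 2" and C: "\<bar>C\<bar> \<le> - Q w0 w1 / 2"
    and ABC: "\<bar>A\<bar> = - Q w1 w2 / 2 \<or> \<bar>B\<bar> = - Q w0 w2 / 2 \<or> \<bar>C\<bar> = - Q w0 w1 / 2"
  shows "\<exists>x. had w0 w1 w2 x = A \<and> had w1 w0 w2 x = B \<and> had w2 w0 w1 x = C"
proof -
  have sb1: "superbase w1 w0 w2" by (rule superbase_swap01[OF sb])
  have sb2: "superbase w2 w0 w1" by (rule superbase_rotate[OF sb])
  note comm = Q_commute[of w2 w1] Q_commute[of w2 w0] Q_commute[of w1 w0]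
  note had_swap' = had_swap[of w2 w0 w1] had_swap[of w0 w1 w2] had_swap[of w1 w0 w2]
  from ABC show ?thesis
    using had_onto_face[OF sb, of A B C] had_onto_face[OF sb1, of B A C] had_onto_face[OF sb2, of C A B]
      A B C unfolding comm had_swap' by blast
qed

text \<open>The origin is a corner of the parallelogram, and half-lattice translations only change
  signs. Over all three coordinates this says that two-torsion points go to vertices.\<close>

lemma abs_had_two_torsion:
  assumes sb: "superbase w0 w1 w2" and u: "u \<in> L"
  shows "\<bar>had w0 w1 w2 ((1/2) *\<^sub>R u)\<bar> = - Q w1 w2 / 2"
proof -
  have neg: "Q w0 w1 < 0" "Q w0 w2 < 0" "Q w1 w2 < 0" using sb by (auto simp: superbase_def)
  then have "had w0 w1 w2 0 = Q w1 w2 / 2"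
    by (intro had_on_face(1)[OF sb]) (simp_all add: bilinear_lzero[OF bilinear_Q])
  then show ?thesis using abs_had_half[OF sb u, of 0] neg by simp
qed

end

section \<open>Parallelepipeds and the Klein orbit in the torus\<close>

lemma independent_tripleI:
  fixes v1 v2 v3 :: "real^3"
  assumes "\<forall>s t r. s *\<^sub>R v1 + t *\<^sub>R v2 + r *\<^sub>R v3 = 0 \<longrightarrow> s = 0 \<and> t = 0 \<and> r = 0"
  shows "v1 \<noteq> v2" "v1 \<noteq> v3" "v2 \<noteq> v3" "independent {v1, v2, v3}"
proof -
  show ne: "v1 \<noteq> v2" "v1 \<noteq> v3" "v2 \<noteq> v3"
    using assms[rule_format, of 1 "- 1" 0] assms[rule_format, of 1 0 "- 1"]
      assms[rule_format, of 0 1 "- 1"] by auto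
  have "\<forall>v\<in>{v1, v2, v3}. u v = 0" if "(\<Sum>v\<in>{v1, v2, v3}. u v *\<^sub>R v) = 0" for u
    using that assms[rule_format, of "u v1" "u v2" "u v3"] ne by (simp add: add.assoc)
  then show "independent {v1, v2, v3}" by (auto simp: dependent_finite)
qed

text \<open>Up to translation this is the image of the unit cube under an injective linear self-map
  of \<open>real^3\<close>, which commutes with closure and interior.\<close>

lemma frontier_parallelepiped:
  assumes "\<forall>s t r. s *\<^sub>R v1 + t *\<^sub>R v2 + r *\<^sub>R v3 = 0 \<longrightarrow> s = 0 \<and> t = 0 \<and> r = 0"
  shows "frontier (parallelepiped p v1 v2 v3) =
    {p + s *\<^sub>R v1 + t *\<^sub>R v2 + r *\<^sub>R v3 | s t r. s \<in> {0..1} \<and> t \<in> {0..1} \<and> r \<in> {0..1} \<and>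
       (s \<in> {0, 1} \<or> t \<in> {0, 1} \<or> r \<in> {0, 1})}"
proof -
  define f :: "real^3 \<Rightarrow> real^3" where "f x = x $ 1 *\<^sub>R v1 + x $ 2 *\<^sub>R v2 + x $ 3 *\<^sub>R v3" for x
  have lin: "linear f" by (rule linearI) (auto simp: f_def algebra_simps)
  have inj: "inj f"
    unfolding linear_injective_0[OF lin]
  proof (intro allI impI)
    fix x assume "f x = 0"
    then have "x $ 1 = 0 \<and> x $ 2 = 0 \<and> x $ 3 = 0" unfolding f_def by (rule assms[rule_format])
    then show "x = 0" by (simp add: vec_eq_iff forall_3)
  qed
  have img: "{p + s *\<^sub>R v1 + t *\<^sub>R v2 + r *\<^sub>R v3 | s t r. P s t r} =
      (+) p ` f ` {x. P (x $ 1) (x $ 2) (x $ 3)}" (is "?A = ?B") for P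
  proof (intro equalityI subsetI)
    fix y assume "y \<in> ?A"
    then obtain s t r where "P s t r" "y = p + s *\<^sub>R v1 + t *\<^sub>R v2 + r *\<^sub>R v3" by blast
    then show "y \<in> ?B"
      by (intro image_eqI[of _ _ "f (vector [s, t, r])"] image_eqI[of _ _ "vector [s, t, r]"])
        (auto simp: f_def add.assoc)
  next
    fix y assume "y \<in> ?B"
    then obtain x where "P (x $ 1) (x $ 2) (x $ 3)" "y = p + f x" by blast
    then show "y \<in> ?A" unfolding f_def mem_Collect_eq by (metis add.assoc)
  qed
  have cb: "{x::real^3. x $ 1 \<in> {0..1} \<and> x $ 2 \<in> {0..1} \<and> x $ 3 \<in> {0..1}} = cbox 0 1"
    by (auto simp: mem_box_cart forall_3)
  have fr: "frontier (cbox 0 1) = {x::real^3. x $ 1 \<in> {0..1} \<and> x $ 2 \<in> {0..1} \<and> x $ 3 \<in> {0..1} \<and>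
      (x $ 1 \<in> {0, 1} \<or> x $ 2 \<in> {0, 1} \<or> x $ 3 \<in> {0, 1})}"
    by (auto simp: frontier_cbox mem_box_cart forall_3)
  have "frontier (f ` cbox 0 1) = f ` frontier (cbox 0 1)"
    unfolding frontier_def closure_injective_linear_image[OF lin inj, symmetric]
      interior_injective_linear_image[OF lin inj] by (simp add: image_set_diff[OF inj])
  then have "frontier (parallelepiped p v1 v2 v3) = (+) p ` f ` frontier (cbox 0 1)"
    unfolding parallelepiped_def img cb by (simp add: frontier_translation)
  then show ?thesis unfolding fr img .
qed

text \<open>Inverse of the Hadamard transform: the three arguments are the pairings of homogeneous
  coordinates with \<open>(1,1,-1,-1)\<close>, \<open>(1,-1,1,-1)\<close> and \<open>(1,-1,-1,1)\<close>.\<close>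
definition hadamard_pt :: "real \<Rightarrow> real \<Rightarrow> real \<Rightarrow> real^3" where
  "hadamard_pt a b c = vector [- (b + c) / 2, - (a + c) / 2, - (a + b) / 2]"

lemma hadamard_pt_nth [simp]:
  "hadamard_pt a b c $ 1 = - (b + c) / 2" "hadamard_pt a b c $ 2 = - (a + c) / 2"
  "hadamard_pt a b c $ 3 = - (a + b) / 2"
  by (simp_all add: hadamard_pt_def)

lemma torus_pt_hadamard:
  "torus_pt x = hadamard_pt (x 0 + x 1 - x 2 - x 3) (x 0 + x 2 - x 1 - x 3) (x 0 + x 3 - x 1 - x 2)"
  by (simp add: torus_pt_def vec_eq_iff forall_3 field_simps)

lemma hadamard_pt_eq_iff: "hadamard_pt a b c = hadamard_pt a' b' c' \<longleftrightarrow> a = a' \<and> b = b' \<and> c = c'"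
  by (auto simp: vec_eq_iff forall_3)

lemma hadamard_pt_edges:
  "hadamard_pt (- \<alpha> / 2) (- \<beta> / 2) (- \<gamma> / 2) + s *\<^sub>R hadamard_pt \<alpha> 0 0 + t *\<^sub>R hadamard_pt 0 \<beta> 0
     + r *\<^sub>R hadamard_pt 0 0 \<gamma> = hadamard_pt ((s - 1/2) * \<alpha>) ((t - 1/2) * \<beta>) ((r - 1/2) * \<gamma>)"
  by (simp add: vec_eq_iff forall_3 field_simps)

text \<open>A nontrivial Klein permutation negates two Hadamard coordinates and \<open>iota\<close>
  negates all three; together they give all eight sign patterns.\<close>

lemma klein_iota_orbit:
  assumes "\<bar>x 0 + x 1 - x 2 - x 3\<bar> = \<alpha>" "\<bar>x 0 + x 2 - x 1 - x 3\<bar> = \<beta>" "\<bar>x 0 + x 3 - x 1 - x 2\<bar> = \<gamma>"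
  shows "{torus_pt (g x) | g. g \<in> klein_iota} =
    {hadamard_pt a b c | a b c. a \<in> {\<alpha>, - \<alpha>} \<and> b \<in> {\<beta>, - \<beta>} \<and> c \<in> {\<gamma>, - \<gamma>}}"
proof -
  define A B C where "A = x 0 + x 1 - x 2 - x 3" and "B = x 0 + x 2 - x 1 - x 3"
    and "C = x 0 + x 3 - x 1 - x 2"
  let ?t = "Transposition.transpose :: nat \<Rightarrow> nat \<Rightarrow> nat \<Rightarrow> nat"
  have inv: "inv (?t a b \<circ> ?t c d) = ?t c d \<circ> ?t a b" for a b c d
    by (simp add: o_inv_distrib)
  have P: "torus_pt (perm_act id x) = hadamard_pt A B C"
    "torus_pt (perm_act (?t 0 1 \<circ> ?t 2 3) x) = hadamard_pt A (- B) (- C)"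
    "torus_pt (perm_act (?t 0 2 \<circ> ?t 1 3) x) = hadamard_pt (- A) B (- C)"
    "torus_pt (perm_act (?t 0 3 \<circ> ?t 1 2) x) = hadamard_pt (- A) (- B) C"
    unfolding torus_pt_hadamard perm_act_def inv hadamard_pt_eq_iff A_def B_def C_def
    by (simp_all add: transpose_def)
  have I: "torus_pt (iota y) = - torus_pt y" for y
    by (simp add: torus_pt_def iota_def vec_eq_iff forall_3)
  have N: "- hadamard_pt a b c = hadamard_pt (- a) (- b) (- c)" for a b c
    by (simp add: vec_eq_iff forall_3 field_simps)
  have "{torus_pt (g x) | g. g \<in> klein_iota} = (\<lambda>g. torus_pt (g x)) ` klein_iota" by blast
  also have "\<dots> = {hadamard_pt (- A) (- B) (- C), hadamard_pt (- A) B C,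
      hadamard_pt A (- B) C, hadamard_pt A B (- C), hadamard_pt A B C,
      hadamard_pt A (- B) (- C), hadamard_pt (- A) B (- C), hadamard_pt (- A) (- B) C}"
    unfolding klein_iota_def klein4_def image_Un image_insert image_empty image_image comp_apply I P N
    by simp
  also have "\<dots> = {hadamard_pt a b c | a b c. a \<in> {A, - A} \<and> b \<in> {B, - B} \<and> c \<in> {C, - C}}"
    by auto
  finally have orbit: "{torus_pt (g x) | g. g \<in> klein_iota} =
    {hadamard_pt a b c | a b c. a \<in> {A, - A} \<and> b \<in> {B, - B} \<and> c \<in> {C, - C}}" .
  \<comment> \<open>The set \<open>{A, - A}\<close> depends only on the absolute value of
    \<open>A\<close>, so the signs at the starting point need not be known.\<close>
  have "{A, - A} = {\<alpha>, - \<alpha>}" "{B, - B} = {\<beta>, - \<beta>}" "{C, - C} = {\<gamma>, - \<gamma>}"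
    using assms unfolding A_def B_def C_def by auto
  then show ?thesis unfolding orbit by simp
qed

section \<open>Theta representatives as half-lattice classes\<close>

lemma (in ppav) superbase_permute:
  assumes "superbase w0 w1 w2" "h1 \<in> {w0, w1, w2}" "h2 \<in> {w0, w1, w2}" "h3 \<in> {w0, w1, w2}"
    "h1 \<noteq> h2" "h1 \<noteq> h3" "h2 \<noteq> h3"
  shows "superbase h1 h2 h3"
proof -
  have "superbase w0 w2 w1" "superbase w1 w0 w2" "superbase w1 w2 w0" "superbase w2 w0 w1" "superbase w2 w1 w0"
    using assms(1) superbase_swap01 superbase_swap12 by blast+
  with assms show ?thesis by auto
qed

text \<open>Writing \<open>b i = lam Q (u i)\<close>, the halves of the \<open>u i\<close> are
  pairwise incongruent modulo \<open>L\<close>. Relative to \<open>u 0\<close> the other three fill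
  the nonzero classes, so they are the halves of a superbase in some order.\<close>

lemma (in ppav) theta_reps_superbase:
  assumes "irreducible_pav Q L" "theta_reps Q L b"
  obtains w0 w1 w2 u where "superbase w0 w1 w2" "u \<in> L"
    "\<And>x. theta Q L (b 0) x = G (x + (1/2) *\<^sub>R u) - Q x x"
    "\<And>x. theta Q L (b 1) x = G (x + (1/2) *\<^sub>R u + (1/2) *\<^sub>R w0) - Q x x"
    "\<And>x. theta Q L (b 2) x = G (x + (1/2) *\<^sub>R u + (1/2) *\<^sub>R w1) - Q x x"
    "\<And>x. theta Q L (b 3) x = G (x + (1/2) *\<^sub>R u + (1/2) *\<^sub>R w2) - Q x x"
proof -
  obtain v0 v1 v2 where sb: "superbase v0 v1 v2" using superbase_exists[OF assms(1)] by blast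
  have "\<exists>w\<in>L. lam Q w = b i" if "i < 4" for i
    using assms(2) that lam_bij unfolding theta_reps_def bij_betw_def by (metis imageE)
  then obtain u where u: "\<And>i. i < 4 \<Longrightarrow> u i \<in> L" "\<And>i. i < 4 \<Longrightarrow> lam Q (u i) = b i" by metis
  have diff: "(1/2) *\<^sub>R u i - (1/2) *\<^sub>R u j \<notin> L" if ij: "i < 4" "j < 4" "i \<noteq> j" for i j
  proof
    assume "(1/2) *\<^sub>R u i - (1/2) *\<^sub>R u j \<in> L"
    moreover have "2 *\<^sub>R lam Q ((1/2) *\<^sub>R u i - (1/2) *\<^sub>R u j) = b i - b j"
      using u(2) ij by (simp add: linear_diff[OF linear_lam] linear_cmul[OF linear_lam] scaleR_diff_right)
    ultimately have "b i - b j \<in> (\<lambda>u. 2 *\<^sub>R lam Q u) ` L" by (metis imageI)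
    then show False using assms(2) ij unfolding theta_reps_def by blast
  qed
  have "\<exists>h\<in>{0, v0, v1, v2}. (1/2) *\<^sub>R (u i - u 0) - (1/2) *\<^sub>R h \<in> L" if "i < 4" for i
  proof -
    have "u i - u 0 \<in> L" using L_diff[OF u(1) u(1)] that by simp
    then show ?thesis using half_lattice_cases[OF sb] by blast
  qed
  then obtain h where h: "\<And>i. i < 4 \<Longrightarrow> h i \<in> {0, v0, v1, v2}"
    "\<And>i. i < 4 \<Longrightarrow> (1/2) *\<^sub>R (u i - u 0) - (1/2) *\<^sub>R h i \<in> L" by metis
  have h0: "h i \<noteq> 0" if "i < 4" "i \<noteq> 0" for i
    using h(2)[of i] diff[of i 0] that by (auto simp: scaleR_diff_right)
  have hne: "h i \<noteq> h j" if ij: "i < 4" "j < 4" "i \<noteq> j" for i j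
  proof
    assume "h i = h j"
    then have "(1/2) *\<^sub>R u i - (1/2) *\<^sub>R u j \<in> L"
      using L_diff[OF h(2)[OF ij(1)] h(2)[OF ij(2)]] by (simp add: algebra_simps)
    with diff ij show False by blast
  qed
  have sbh: "superbase (h 1) (h 2) (h 3)"
    by (rule superbase_permute[OF sb]) (use h(1)[of 1] h(1)[of 2] h(1)[of 3] h0[of 1] h0[of 2] h0[of 3] hne in auto)
  have th: "theta Q L (b i) x = G (x + (1/2) *\<^sub>R u i) - Q x x" if "i < 4" for i x
    by (rule theta_eq_G) (simp add: linear_cmul[OF linear_lam] u(2)[OF that])
  have "G (x + (1/2) *\<^sub>R u i) = G (x + (1/2) *\<^sub>R u 0 + (1/2) *\<^sub>R h i)" if "i < 4" for i x
    by (rule G_cong) (use h(2)[OF that] in \<open>simp add: algebra_simps\<close>)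
  with th have th': "theta Q L (b i) x = G (x + (1/2) *\<^sub>R u 0 + (1/2) *\<^sub>R h i) - Q x x" if "i < 4" for i x
    using that by simp
  show thesis
    by (rule that[OF sbh u(1)[of 0] th[of 0] th'[of 1] th'[of 2] th'[of 3]]) simp_all
qed

theorem theorem4p7:
  fixes Q :: "real^2 \<Rightarrow> real^2 \<Rightarrow> real" and L :: "(real^2) set"
    and b :: "nat \<Rightarrow> real^2"
  assumes "principal_polarization Q L"
    and "irreducible_pav Q L"
    and "theta_reps Q L b"
  shows "\<exists>p v1 v2 v3. v1 \<noteq> v2 \<and> v1 \<noteq> v3 \<and> v2 \<noteq> v3 \<and> independent {v1, v2, v3} \<and>
           (\<lambda>x. torus_pt (\<lambda>i. theta Q L (b i) x)) ` UNIV = frontier (parallelepiped p v1 v2 v3) \<and>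
           parallelepiped_vertices p v1 v2 v3 =
             {torus_pt (g (\<lambda>i. theta Q L (b i) 0)) | g. g \<in> klein_iota}"
proof -
  interpret ppav Q L by unfold_locales (rule assms(1))
  obtain w0 w1 w2 u where sb: "superbase w0 w1 w2" and u: "u \<in> L" and th:
    "\<And>x. theta Q L (b 0) x = G (x + (1/2) *\<^sub>R u) - Q x x"
    "\<And>x. theta Q L (b 1) x = G (x + (1/2) *\<^sub>R u + (1/2) *\<^sub>R w0) - Q x x"
    "\<And>x. theta Q L (b 2) x = G (x + (1/2) *\<^sub>R u + (1/2) *\<^sub>R w1) - Q x x"
    "\<And>x. theta Q L (b 3) x = G (x + (1/2) *\<^sub>R u + (1/2) *\<^sub>R w2) - Q x x"
    using theta_reps_superbase[OF assms(2,3)] by blast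
  define \<alpha> \<beta> \<gamma> where "\<alpha> = - Q w1 w2" and "\<beta> = - Q w0 w2" and "\<gamma> = - Q w0 w1"
  have pos: "\<alpha> > 0" "\<beta> > 0" "\<gamma> > 0"
    using sb by (auto simp: superbase_def \<alpha>_def \<beta>_def \<gamma>_def)
  \<comment> \<open>The corner with all Hadamard coordinates lowest; the edges below run along the
    Hadamard axes with full lengths \<alpha>, \<beta>, \<gamma>.\<close>
  define p where "p = hadamard_pt (- \<alpha> / 2) (- \<beta> / 2) (- \<gamma> / 2)"
  define v1 v2 v3 where "v1 = hadamard_pt \<alpha> 0 0" and "v2 = hadamard_pt 0 \<beta> 0" and "v3 = hadamard_pt 0 0 \<gamma>"
  note edges = hadamard_pt_edges[of \<alpha> \<beta> \<gamma>, folded p_def v1_def v2_def v3_def]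
  have indep: "\<forall>s t r. s *\<^sub>R v1 + t *\<^sub>R v2 + r *\<^sub>R v3 = 0 \<longrightarrow> s = 0 \<and> t = 0 \<and> r = 0"
  proof (intro allI impI)
    fix s t r assume *: "s *\<^sub>R v1 + t *\<^sub>R v2 + r *\<^sub>R v3 = 0"
    have "p + s *\<^sub>R v1 + t *\<^sub>R v2 + r *\<^sub>R v3 = p + (s *\<^sub>R v1 + t *\<^sub>R v2 + r *\<^sub>R v3)"
      by (simp add: add.assoc)
    then have "hadamard_pt ((s - 1/2) * \<alpha>) ((t - 1/2) * \<beta>) ((r - 1/2) * \<gamma>) = p"
      using * edges by simp
    then show "s = 0 \<and> t = 0 \<and> r = 0" using pos unfolding p_def hadamard_pt_eq_iff by (auto simp: field_simps)
  qed
  let ?H = "\<lambda>x. hadamard_pt (had w0 w1 w2 x) (had w1 w0 w2 x) (had w2 w0 w1 x)"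
  have psi: "torus_pt (\<lambda>i. theta Q L (b i) x) = ?H (x + (1/2) *\<^sub>R u)" for x
    unfolding torus_pt_hadamard th hadamard_pt_eq_iff had_def by simp
  \<comment> \<open>The offset by half of \<open>u\<close> disappears because a translation maps the
    plane onto itself.\<close>
  have "range (\<lambda>x. torus_pt (\<lambda>i. theta Q L (b i) x)) = range ?H"
  proof -
    have "?H y \<in> range (\<lambda>x. ?H (x + (1/2) *\<^sub>R u))" for y
      by (intro image_eqI[of _ _ "y - (1/2) *\<^sub>R u"]) auto
    then show ?thesis unfolding psi by blast
  qed
  also have "\<dots> = frontier (parallelepiped p v1 v2 v3)"
  proof (intro equalityI subsetI)
    fix y assume "y \<in> range ?H"
    then obtain x where y: "y = ?H x" by blast
    note box = on_box_all[OF sb, of x, unfolded on_box_def, folded \<alpha>_def \<beta>_def \<gamma>_def]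
    have coord: "(h / k + 1/2 - 1/2) * k = h" "\<bar>h\<bar> \<le> k / 2 \<Longrightarrow> h / k + 1/2 \<in> {0..1}"
      "\<bar>h\<bar> = k / 2 \<Longrightarrow> h / k + 1/2 \<in> {0, 1}" if "k > 0" for h k :: real
      using that by (auto simp: field_simps abs_if split: if_splits)
    show "y \<in> frontier (parallelepiped p v1 v2 v3)"
      unfolding frontier_parallelepiped[OF indep] edges mem_Collect_eq
      by (rule exI[of _ "had w0 w1 w2 x / \<alpha> + 1/2"], rule exI[of _ "had w1 w0 w2 x / \<beta> + 1/2"],
          rule exI[of _ "had w2 w0 w1 x / \<gamma> + 1/2"])
        (use box coord[OF pos(1)] coord[OF pos(2)] coord[OF pos(3)] in \<open>simp only: y simp_thms; blast\<close>)
  next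
    fix y assume "y \<in> frontier (parallelepiped p v1 v2 v3)"
    then obtain s t r where str: "y = hadamard_pt ((s - 1/2) * \<alpha>) ((t - 1/2) * \<beta>) ((r - 1/2) * \<gamma>)"
      "s \<in> {0..1}" "t \<in> {0..1}" "r \<in> {0..1}" "s \<in> {0, 1} \<or> t \<in> {0, 1} \<or> r \<in> {0, 1}"
      unfolding frontier_parallelepiped[OF indep] edges by blast
    have coord: "s \<in> {0..1} \<Longrightarrow> \<bar>(s - 1/2) * k\<bar> \<le> k / 2" "s \<in> {0, 1} \<Longrightarrow> \<bar>(s - 1/2) * k\<bar> = k / 2"
      if "k > 0" for s k :: real
    proof -
      assume "s \<in> {0..1}"
      then have "\<bar>s - 1/2\<bar> \<le> 1/2" by (simp only: abs_le_iff atLeastAtMost_iff) linarith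
      then have "\<bar>s - 1/2\<bar> * k \<le> 1/2 * k" using that by (intro mult_right_mono) simp_all
      then show "\<bar>(s - 1/2) * k\<bar> \<le> k / 2" using that by (simp add: abs_mult)
    qed (use that in \<open>auto simp: abs_mult\<close>)
    have "\<bar>(s - 1/2) * \<alpha>\<bar> = \<alpha> / 2 \<or> \<bar>(t - 1/2) * \<beta>\<bar> = \<beta> / 2 \<or> \<bar>(r - 1/2) * \<gamma>\<bar> = \<gamma> / 2"
      using str(5) coord(2)[OF pos(1)] coord(2)[OF pos(2)] coord(2)[OF pos(3)] by blast
    then obtain x where "had w0 w1 w2 x = (s - 1/2) * \<alpha>" "had w1 w0 w2 x = (t - 1/2) * \<beta>"
      "had w2 w0 w1 x = (r - 1/2) * \<gamma>"
      using had_onto_box[OF sb, folded \<alpha>_def \<beta>_def \<gamma>_def, OF coord(1)[OF pos(1) str(2)]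
          coord(1)[OF pos(2) str(3)] coord(1)[OF pos(3) str(4)]] by blast
    then have "y = ?H x" using str(1) by simp
    then show "y \<in> range ?H" by blast
  qed
  finally have img: "range (\<lambda>x. torus_pt (\<lambda>i. theta Q L (b i) x)) = frontier (parallelepiped p v1 v2 v3)" .
  have "parallelepiped_vertices p v1 v2 v3 =
    {hadamard_pt a b c | a b c. a \<in> {\<alpha>/2, - (\<alpha>/2)} \<and> b \<in> {\<beta>/2, - (\<beta>/2)} \<and> c \<in> {\<gamma>/2, - (\<gamma>/2)}}"
    (is "_ = ?R")
  proof (intro equalityI subsetI)
    fix y assume "y \<in> parallelepiped_vertices p v1 v2 v3"
    then show "y \<in> ?R" unfolding parallelepiped_vertices_def edges by fastforce
  next
    have coord: "\<exists>s\<in>{0, 1}. a = (s - 1/2) * k" if "a \<in> {k/2, - (k/2)}" for a k :: real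
      using that by auto
    fix y assume "y \<in> ?R"
    then obtain a b c where y: "y = hadamard_pt a b c" and abc:
      "a \<in> {\<alpha>/2, - (\<alpha>/2)}" "b \<in> {\<beta>/2, - (\<beta>/2)}" "c \<in> {\<gamma>/2, - (\<gamma>/2)}"
      by blast
    obtain s t r where "s \<in> {0, 1}" "a = (s - 1/2) * \<alpha>" "t \<in> {0, 1}" "b = (t - 1/2) * \<beta>"
      "r \<in> {0, 1}" "c = (r - 1/2) * \<gamma>"
      using coord[OF abc(1)] coord[OF abc(2)] coord[OF abc(3)] by metis
    then show "y \<in> parallelepiped_vertices p v1 v2 v3"
      unfolding parallelepiped_vertices_def edges y by blast
  qed
  \<comment> \<open>At \<open>x = 0\<close> the Hadamard coordinates are those of half of
    \<open>u\<close>, so \<open>abs_had_two_torsion\<close> supplies the hypotheses of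
    \<open>klein_iota_orbit\<close>.\<close>
  also have "\<dots> = {torus_pt (g (\<lambda>i. theta Q L (b i) 0)) | g. g \<in> klein_iota}"
    using abs_had_two_torsion[OF sb u] abs_had_two_torsion[OF superbase_swap01[OF sb] u]
      abs_had_two_torsion[OF superbase_rotate[OF sb] u]
    by (intro klein_iota_orbit[symmetric]; unfold th; simp add: had_def \<alpha>_def \<beta>_def \<gamma>_def)
  finally show ?thesis using img independent_tripleI[OF indep] by blast
qed

end
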